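(* Let $d\ge 2$ be an integer, let $T$ be the $d$-regular rooted tree, and let $G\le \mathrm{Aut}(T)$ be a super strongly fractal group. Then the fixed-point proportion of $G$ is zero: $$\mathrm{FPP}(G)=\lim_{n\to\infty}\frac{\#\{g\in\pi_n(G): g \text{ fixes a vertex in } \mathcal{L}_n\}}{|\pi_n(G)|}=0.$$
   Context: The $d$-regular rooted tree $T$ is the infinite rooted tree in which every vertex has exactly $d$ immediate descendants; its vertices are identified with the finite words over $X=\{1,\dots,d\}$, the root being the empty word. $\mathcal{L}_n$ denotes the set of vertices at distance exactly $n$ from the root (words of length $n$), and $T^n$ the finite subtree of vertices at distance at most $n$ from the root. $\mathrm{Aut}(T)$ is the group of bijections of the vertex set preserving adjacency (and hence the root and each level). $\pi_n:\mathrm{Aut}(T)\to\mathrm{Aut}(T^n)$ is the restriction map to $T^n$. For $g\in\mathrm{Aut}(T)$ and a vertex $v$, the section $g|_v\in\mathrm{Aut}(T)$ is the unique automorphism with $g(vw)=g(v)\,g|_v(w)$ for all words $w$. Write $\varphi_v(g):=g|_v$. For $G\le\mathrm{Aut}(T)$, $\mathrm{St}_G(n)$ is the subgroup of those $g\in G$ fixing every vertex of $\mathcal{L}_n$. $G\le\mathrm{Aut}(T)$ is level-transitive if it acts transitively on $\mathcal{L}_n$ for every $n\ge1$; self-similar if $g|_v\in G$ for all $g\in G$ and all vertices $v$; and super strongly fractal if it is self-similar, level-transitive and $\varphi_v(\mathrm{St}_G(n))=G$ for all $n\ge1$ and all $v\in\mathcal{L}_n$. The limit defining $\mathrm{FPP}(G)$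 exists for every subgroup $G\le\mathrm{Aut}(T)$. *)

theory Defs
  imports Complex_Main "HOL-Library.Cardinality" "HOL-Algebra.Group"
begin

text \<open>
  The alphabet \<open>X\<close> is a finite type \<open>'x\<close>, so \<open>d = CARD('x)\<close>. The vertices of the
  \<open>d\<close>-regular rooted tree \<open>T\<close> are the words \<open>'x list\<close>, the root being the empty word.
\<close>

definition tree_adj :: "'x list \<Rightarrow> 'x list \<Rightarrow> bool" where
  "tree_adj v w \<longleftrightarrow> (\<exists>x. w = v @ [x] \<or> v = w @ [x])"

definition level :: "nat \<Rightarrow> 'x list set" where
  "level n = {v. length v = n}"

definition truncated_tree :: "nat \<Rightarrow> 'x list set" where
  "truncated_tree n = {v. length v \<le> n}"

definition tree_auts :: "('x list \<Rightarrow> 'x list) set" where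
  "tree_auts = {g. bij g \<and> (\<forall>v w. tree_adj (g v) (g w) \<longleftrightarrow> tree_adj v w)}"

definition tree_Aut :: "('x list \<Rightarrow> 'x list) monoid" where
  "tree_Aut = \<lparr>carrier = tree_auts, monoid.mult = (\<circ>), one = id\<rparr>"

definition tree_section :: "('x list \<Rightarrow> 'x list) \<Rightarrow> 'x list \<Rightarrow> ('x list \<Rightarrow> 'x list)" where
  "tree_section g v = (THE h. h \<in> tree_auts \<and> (\<forall>w. g (v @ w) = g v @ h w))"

definition level_stabilizer :: "('x list \<Rightarrow> 'x list) set \<Rightarrow> nat \<Rightarrow> ('x list \<Rightarrow> 'x list) set" where
  "level_stabilizer G n = {g \<in> G. \<forall>v \<in> level n. g v = v}"

definition level_transitive :: "('x list \<Rightarrow> 'x list) set \<Rightarrow> bool" where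
  "level_transitive G \<longleftrightarrow> (\<forall>n\<ge>1. \<forall>u \<in> level n. \<forall>v \<in> level n. \<exists>g \<in> G. g u = v)"

definition self_similar :: "('x list \<Rightarrow> 'x list) set \<Rightarrow> bool" where
  "self_similar G \<longleftrightarrow> (\<forall>g \<in> G. \<forall>v. tree_section g v \<in> G)"

definition super_strongly_fractal :: "('x list \<Rightarrow> 'x list) set \<Rightarrow> bool" where
  "super_strongly_fractal G \<longleftrightarrow> self_similar G \<and> level_transitive G \<and>
     (\<forall>n\<ge>1. \<forall>v \<in> level n. (\<lambda>g. tree_section g v) ` level_stabilizer G n = G)"

text \<open>
  Automorphisms of the finite tree \<open>T\<^sup>n\<close> are represented by functions that are
  \<open>undefined\<close> outside \<open>T\<^sup>n\<close>, so that distinct elements of \<open>\<pi>\<^sub>n(G)\<close> are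
  distinct functions.
\<close>

definition tree_proj :: "nat \<Rightarrow> ('x list \<Rightarrow> 'x list) \<Rightarrow> ('x list \<Rightarrow> 'x list)" where
  "tree_proj n g = restrict g (truncated_tree n)"

definition level_FPP :: "('x list \<Rightarrow> 'x list) set \<Rightarrow> nat \<Rightarrow> real" where
  "level_FPP G n =
     real (card {g \<in> tree_proj n ` G. \<exists>v \<in> level n. g v = v}) / real (card (tree_proj n ` G))"

definition FPP :: "('x list \<Rightarrow> 'x list) set \<Rightarrow> real" where
  "FPP G = lim (level_FPP G)"


subsection \<open>Well-definedness of the notions above\<close>

lemma tree_auts_bij: "g \<in> tree_auts \<Longrightarrow> bij g"
  by (simp add: tree_auts_def)

lemma tree_auts_adj: "g \<in> tree_auts \<Longrightarrow> tree_adj (g v) (g w) \<longleftrightarrow> tree_adj v w"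
  by (simp add: tree_auts_def)

lemma tree_auts_inv:
  assumes "g \<in> tree_auts" shows "inv_into UNIV g \<in> tree_auts"
  using assms unfolding tree_auts_def
  by (auto simp: bij_imp_bij_inv) (metis bij_inv_eq_iff)+

lemma group_tree_Aut: "group tree_Aut"
proof (rule groupI)
  fix g :: "'a list \<Rightarrow> 'a list" assume "g \<in> carrier tree_Aut"
  then have g: "g \<in> tree_auts" by (simp add: tree_Aut_def)
  have "inv_into UNIV g \<circ> g = id" using tree_auts_bij[OF g] by (simp add: bij_is_inj)
  then show "\<exists>h\<in>carrier tree_Aut. h \<otimes>\<^bsub>tree_Aut\<^esub> g = \<one>\<^bsub>tree_Aut\<^esub>"
    using tree_auts_inv[OF g] by (auto simp: tree_Aut_def)
qed (auto simp: tree_Aut_def tree_auts_def bij_comp comp_assoc)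

lemma card_tree_neighbours:
  fixes v :: "'x::finite list"
  shows "card {w. tree_adj v w} = (if v = [] then CARD('x) else Suc CARD('x))"
proof -
  have c: "card (range (\<lambda>x. v @ [x])) = CARD('x)"
    by (subst card_image) (auto simp: inj_on_def)
  show ?thesis
  proof (cases v rule: rev_cases)
    case Nil
    then have "{w. tree_adj v w} = range (\<lambda>x. v @ [x])" by (auto simp: tree_adj_def)
    with c Nil show ?thesis by simp
  next
    case (snoc u y)
    then have "{w. tree_adj v w} = insert u (range (\<lambda>x. v @ [x]))"
      by (auto simp: tree_adj_def)
    moreover have "u \<notin> range (\<lambda>x. v @ [x])" using snoc by auto
    ultimately show ?thesis using c snoc by simp
  qed
qed

lemma tree_auts_root:
  fixes g :: "'x::finite list \<Rightarrow> 'x list"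
  assumes g: "g \<in> tree_auts" shows "g [] = []"
proof -
  have b: "bij g" by (rule tree_auts_bij[OF g])
  have "{w. tree_adj (g []) w} = g ` {w. tree_adj [] w}"
  proof (intro equalityI subsetI)
    fix w assume w: "w \<in> {w. tree_adj (g []) w}"
    obtain u where "w = g u" using b by (metis bij_pointE)
    then show "w \<in> g ` {w. tree_adj [] w}" using w tree_auts_adj[OF g] by auto
  qed (auto simp: tree_auts_adj[OF g])
  then have "card {w. tree_adj (g []) w} = card {w. tree_adj ([] :: 'x list) w}"
    using card_image[OF inj_on_subset[OF bij_is_inj[OF b] subset_UNIV]] by simp
  then show ?thesis by (simp add: card_tree_neighbours split: if_splits)
qed

lemma tree_auts_snoc:
  fixes g :: "'x::finite list \<Rightarrow> 'x list"
  assumes g: "g \<in> tree_auts" shows "\<exists>y. g (v @ [x]) = g v @ [y]"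
proof (induction v arbitrary: x rule: rev_induct)
  case Nil
  have "tree_adj (g []) (g [x])"
    by (subst tree_auts_adj[OF g]) (auto simp: tree_adj_def)
  then show ?case by (auto simp: tree_auts_root[OF g] tree_adj_def)
next
  case (snoc z u)
  obtain z' where z': "g (u @ [z]) = g u @ [z']" using snoc by blast
  have "tree_adj (g (u @ [z])) (g ((u @ [z]) @ [x]))"
    by (subst tree_auts_adj[OF g]) (auto simp: tree_adj_def)
  moreover have "g ((u @ [z]) @ [x]) \<noteq> g u"
    using tree_auts_bij[OF g] by (auto dest!: bij_is_inj injD)
  ultimately show ?case using z' by (auto simp: tree_adj_def)
qed

lemma tree_auts_length:
  fixes g :: "'x::finite list \<Rightarrow> 'x list"
  assumes g: "g \<in> tree_auts" shows "length (g v) = length v"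
proof (induction v rule: rev_induct)
  case (snoc x v)
  then show ?case using tree_auts_snoc[OF g, of v x] by auto
qed (simp add: tree_auts_root[OF g])

lemma tree_section_ex1:
  fixes g :: "'x::finite list \<Rightarrow> 'x list"
  assumes g: "g \<in> tree_auts"
  shows "\<exists>!h. h \<in> tree_auts \<and> (\<forall>w. g (v @ w) = g v @ h w)"
proof -
  define h where "h w = drop (length v) (g (v @ w))" for w
  have pre: "\<exists>u'. f (v @ w) = f v @ u'" if "f \<in> tree_auts"
    for f :: "'x list \<Rightarrow> 'x list" and v w
  proof (induction w rule: rev_induct)
    case (snoc x w)
    then show ?case using tree_auts_snoc[OF that, of "v @ w" x] by auto
  qed simp
  have h: "g (v @ w) = g v @ h w" for w
    using pre[OF g, of v w] tree_auts_length[OF g, of v] by (auto simp: h_def)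
  have adj: "tree_adj (u @ a) (u @ b) \<longleftrightarrow> tree_adj a b" for u a b :: "'x list"
    by (simp add: tree_adj_def)
  have "inj h"
  proof (rule injI)
    fix a b assume "h a = h b"
    then have "g (v @ a) = g (v @ b)" using h by simp
    then have "v @ a = v @ b" using tree_auts_bij[OF g] by (metis bij_is_inj injD)
    then show "a = b" by simp
  qed
  moreover have "surj h"
  proof (rule surjI)
    fix u
    let ?w = "drop (length v) (inv_into UNIV g (g v @ u))"
    obtain u' where u': "inv_into UNIV g (g v @ u) = inv_into UNIV g (g v) @ u'"
      using pre[OF tree_auts_inv[OF g]] by blast
    have "inv_into UNIV g (g v) = v" using tree_auts_bij[OF g] by (simp add: bij_is_inj inv_f_f)
    with u' have e: "inv_into UNIV g (g v @ u) = v @ u'" by simp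
    then have "g (v @ u') = g v @ u" using tree_auts_bij[OF g] by (metis bij_inv_eq_iff)
    then show "h ?w = u" using e h by simp
  qed
  ultimately have "bij h" by (simp add: bij_def)
  moreover have "tree_adj (h a) (h b) \<longleftrightarrow> tree_adj a b" for a b
    using tree_auts_adj[OF g, of "v @ a" "v @ b"] by (simp add: h adj)
  ultimately have "h \<in> tree_auts" by (simp add: tree_auts_def)
  with h show ?thesis
    by (intro ex1I[of _ h]) (auto simp: fun_eq_iff)
qed

lemma tree_section:
  fixes g :: "'x::finite list \<Rightarrow> 'x list"
  assumes "g \<in> tree_auts"
  shows "tree_section g v \<in> tree_auts" "g (v @ w) = g v @ tree_section g v w"
  using theI'[OF tree_section_ex1[OF assms, of v]] unfolding tree_section_def by blast+

end

theory Submission imports Defs begin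

text \<open>
  Choose \<open>g\<close> uniformly in \<open>\<pi>\<^sub>n(G)\<close> and let \<open>X\<^sub>n\<close> be the number of vertices of level \<open>n\<close> that it fixes.
  Conditionally on \<open>\<pi>\<^sub>n(g)\<close>, the section of \<open>g\<close> at each fixed vertex of level \<open>n\<close> is uniformly
  distributed in \<open>\<pi>\<^sub>m(G)\<close>, because \<open>St\<^sub>G(n)\<close> maps onto \<open>G\<close> by sections. Together with Burnside's
  lemma this makes \<open>X\<close> a martingale of mean 1. Moreover, if \<open>X\<^sub>n \<ge> 1\<close>, then the section at a fixed
  vertex is trivial on \<open>m\<close> levels with probability \<open>c = 1/|\<pi>\<^sub>m(G)|\<close>, and then \<open>X\<^bsub>n+m\<^esub> \<ge> d\<^sup>m\<close>.
  For \<open>d\<^sup>m > M\<close> the mean of \<open>min X\<^sub>n M\<close> therefore drops by at least \<open>c P(1 \<le> X\<^sub>n < M)\<close> every \<open>m\<close>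
  levels. As it is nonnegative, these probabilities become small, while \<open>P(X\<^sub>n \<ge> M) \<le> 1/M\<close> by Markov.
\<close>

section \<open>Push-forward of a uniform distribution\<close>

text \<open>When all fibres of \<open>p\<close> over \<open>H\<close> have equal size, the uniform
  distribution on \<open>F\<close> is carried to the uniform one on \<open>H\<close>. An inequality
  between fibre sizes suffices as hypothesis, because \<open>h\<close> and \<open>h'\<close> can be
  exchanged; a single injection then verifies it.\<close>

lemma sum_uniform_fibres:
  fixes f :: "'b \<Rightarrow> real"
  assumes "finite F" "finite H" "p ` F \<subseteq> H"
    and le: "\<And>h h'. h \<in> H \<Longrightarrow> h' \<in> H \<Longrightarrow> card {x \<in> F. p x = h} \<le> card {x \<in> F. p x = h'}"
  shows "(\<Sum>x\<in>F. f (p x)) * real (card H) = real (card F) * (\<Sum>h\<in>H. f h)"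
proof (cases "H = {}")
  case True
  then show ?thesis using assms by auto
next
  case False
  then obtain h0 where h0: "h0 \<in> H" by blast
  define K where "K = card {x \<in> F. p x = h0}"
  have K: "card {x \<in> F. p x = h} = K" if "h \<in> H" for h
    using le[OF that h0] le[OF h0 that] unfolding K_def by simp
  have *: "(\<Sum>x\<in>F. \<phi> (p x)) = real K * (\<Sum>h\<in>H. \<phi> h)" for \<phi> :: "'b \<Rightarrow> real"
  proof -
    have "(\<Sum>x\<in>F. \<phi> (p x)) = (\<Sum>h\<in>H. \<Sum>x\<in>{x \<in> F. p x = h}. \<phi> (p x))"
      using sum.group[OF assms(1-3), of "\<lambda>x. \<phi> (p x)"] by simp
    also have "\<dots> = (\<Sum>h\<in>H. real K * \<phi> h)"
      by (intro sum.cong) (auto simp: K)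
    finally show ?thesis by (simp add: sum_distrib_left)
  qed
  from *[of "\<lambda>_. 1"] have "real (card F) = real K * real (card H)" by simp
  then show ?thesis by (simp add: *[of f])
qed

section \<open>Levels, restrictions and fixed vertices\<close>

lemma finite_level: "finite (level n :: 'x::finite list set)"
  using finite_lists_length_eq[of "UNIV :: 'x set" n] by (simp add: level_def)

lemma finite_truncated_tree: "finite (truncated_tree n :: 'x::finite list set)"
  using finite_lists_length_le[of "UNIV :: 'x set" n] by (simp add: truncated_tree_def)

lemma card_level: "card (level n :: 'x::finite list set) = CARD('x) ^ n"
  using card_lists_length_eq[of "UNIV :: 'x set" n] by (simp add: level_def)

lemma tree_proj_apply: "length v \<le> N \<Longrightarrow> tree_proj N g v = g v"
  by (simp add: tree_proj_def truncated_tree_def)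

lemma tree_proj_eq_iff:
  "tree_proj N g = tree_proj N h \<longleftrightarrow> (\<forall>v. length v \<le> N \<longrightarrow> g v = h v)"
  by (auto simp: tree_proj_def truncated_tree_def restrict_def fun_eq_iff)

lemma tree_proj_tree_proj: "n \<le> N \<Longrightarrow> tree_proj n (tree_proj N g) = tree_proj n g"
  by (simp add: tree_proj_eq_iff tree_proj_apply)

definition fixed_count :: "nat \<Rightarrow> ('x list \<Rightarrow> 'x list) \<Rightarrow> nat" where
  "fixed_count n g = card {v \<in> level n. g v = v}"

lemma fixed_count_tree_proj: "n \<le> N \<Longrightarrow> fixed_count n (tree_proj N g) = fixed_count n g"
  unfolding fixed_count_def
  by (rule arg_cong[of _ _ card]) (auto simp: level_def tree_proj_apply)

text \<open>A version of the section of depth \<open>m\<close> that can be read off the restriction to a finite subtree.\<close>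

definition finite_section :: "nat \<Rightarrow> 'x list \<Rightarrow> ('x list \<Rightarrow> 'x list) \<Rightarrow> ('x list \<Rightarrow> 'x list)" where
  "finite_section m v g = tree_proj m (\<lambda>w. drop (length v) (g (v @ w)))"

lemma finite_section_tree_proj:
  fixes g :: "'x::finite list \<Rightarrow> 'x list"
  assumes "g \<in> tree_auts" "length v + m \<le> N"
  shows "finite_section m v (tree_proj N g) = tree_proj m (tree_section g v)"
  using assms
  by (simp add: finite_section_def tree_proj_eq_iff tree_proj_apply tree_section(2)[OF assms(1)]
      tree_auts_length)

lemma tree_section_eqI:
  fixes g :: "'x::finite list \<Rightarrow> 'x list"
  assumes "g \<in> tree_auts" "\<And>w. g (v @ w) = g v @ h w"
  shows "tree_section g v = h"
  using assms by (auto simp: tree_section(2) fun_eq_iff)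

lemma tree_auts_fixes_prefix:
  fixes g :: "'x::finite list \<Rightarrow> 'x list"
  assumes "g \<in> tree_auts"
  shows "g (v @ w) = v @ w \<longleftrightarrow> g v = v \<and> tree_section g v w = w"
  using assms by (simp add: tree_section(2) tree_auts_length)

text \<open>Cutting a word after \<open>n\<close> letters gives a bijection: the word is fixed
  exactly when its prefix is fixed and the section at the prefix fixes the rest.\<close>

lemma fixed_count_add:
  fixes g :: "'x::finite list \<Rightarrow> 'x list"
  assumes g: "g \<in> tree_auts"
  shows "fixed_count (n + m) g = (\<Sum>v\<in>{v \<in> level n. g v = v}. fixed_count m (tree_section g v))"
proof -
  let ?S = "Sigma {v \<in> level n. g v = v} (\<lambda>v. {w \<in> level m. tree_section g v w = w})"
  have "bij_betw (\<lambda>(v, w). v @ w) ?S {u \<in> level (n + m). g u = u}"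
  proof (rule bij_betwI[where g = "\<lambda>u. (take n u, drop n u)"])
    show "(\<lambda>u. (take n u, drop n u)) \<in> {u \<in> level (n + m). g u = u} \<rightarrow> ?S"
    proof
      fix u assume "u \<in> {u \<in> level (n + m). g u = u}"
      then show "(take n u, drop n u) \<in> ?S"
        using tree_auts_fixes_prefix[OF g, of "take n u" "drop n u"] by (auto simp: level_def)
    qed
  qed (auto simp: level_def tree_auts_fixes_prefix[OF g])
  then have "card {u \<in> level (n + m). g u = u} = card ?S"
    by (simp add: bij_betw_same_card)
  then show ?thesis
    by (simp add: fixed_count_def card_SigmaI finite_level)
qed

section \<open>The group, its finite quotients and averages over them\<close>

locale ssf_group =
  fixes G :: "('x::finite list \<Rightarrow> 'x list) set"
  assumes subgroup: "subgroup G tree_Aut"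
    and ssf: "super_strongly_fractal G"
begin

abbreviation Q :: "nat \<Rightarrow> ('x list \<Rightarrow> 'x list) set" where
  "Q n \<equiv> tree_proj n ` G"

text \<open>Summing over this set plays the role of conditioning on the action on the first
  \<open>n\<close> levels.\<close>

definition fibre :: "nat \<Rightarrow> nat \<Rightarrow> ('x list \<Rightarrow> 'x list) \<Rightarrow> ('x list \<Rightarrow> 'x list) set" where
  "fibre N n a = {b \<in> Q N. tree_proj n b = a}"

definition mean :: "nat \<Rightarrow> (('x list \<Rightarrow> 'x list) \<Rightarrow> real) \<Rightarrow> real" where
  "mean n f = (\<Sum>b\<in>Q n. f b) / real (card (Q n))"

lemma G_auts: "g \<in> G \<Longrightarrow> g \<in> tree_auts"
  using subgroup.subset[OF subgroup] by (auto simp: tree_Aut_def)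

lemma G_id: "id \<in> G"
  using subgroup.one_closed[OF subgroup] by (simp add: tree_Aut_def)

lemma G_comp: "g \<in> G \<Longrightarrow> h \<in> G \<Longrightarrow> g \<circ> h \<in> G"
  using subgroup.m_closed[OF subgroup, of g h] by (simp add: tree_Aut_def)

lemma G_div:
  assumes "g \<in> G" "h \<in> G"
  obtains s where "s \<in> G" "s \<circ> g = h"
proof -
  let ?i = "inv\<^bsub>tree_Aut\<^esub> g"
  have i: "?i \<in> G" using subgroup.m_inv_closed[OF subgroup] assms by blast
  have "?i \<otimes>\<^bsub>tree_Aut\<^esub> g = \<one>\<^bsub>tree_Aut\<^esub>"
    using group.l_inv[OF group_tree_Aut] assms subgroup.subset[OF subgroup] by blast
  then have "?i \<circ> g = id" by (simp add: tree_Aut_def)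
  then have "(h \<circ> ?i) \<circ> g = h" by (simp add: comp_assoc)
  with i G_comp[OF assms(2) i] that show thesis by blast
qed

lemma section_in_G: "g \<in> G \<Longrightarrow> tree_section g v \<in> G"
  using ssf by (auto simp: super_strongly_fractal_def self_similar_def)

lemma stabilizer_section:
  assumes "n \<ge> 1" "v \<in> level n" "h \<in> G"
  obtains s where "s \<in> G" "\<And>u. length u \<le> n \<Longrightarrow> s u = u" "tree_section s v = h"
proof -
  have "h \<in> (\<lambda>g. tree_section g v) ` level_stabilizer G n"
    using ssf assms by (auto simp: super_strongly_fractal_def)
  then obtain s where s: "s \<in> G" "\<And>u. u \<in> level n \<Longrightarrow> s u = u" "tree_section s v = h"
    by (auto simp: level_stabilizer_def)
  have "s u = u" if "length u \<le> n" for u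
  proof -
    \<comment> \<open>Pad \<open>u\<close> to a word of length \<open>n\<close> with an arbitrary
      letter: an automorphism fixing a word fixes each of its prefixes.\<close>
    have "u @ replicate (n - length u) undefined \<in> level n" using that by (simp add: level_def)
    then show ?thesis using s(2) tree_auts_fixes_prefix[OF G_auts[OF s(1)]] by blast
  qed
  with s that show thesis by blast
qed

lemma finite_Q: "finite (Q n)"
proof (rule finite_subset)
  show "Q n \<subseteq> PiE (truncated_tree n) (\<lambda>_. truncated_tree n)"
    by (auto simp: tree_proj_def truncated_tree_def tree_auts_length[OF G_auts] split: if_splits)
  show "finite (PiE (truncated_tree n :: 'x list set) (\<lambda>_. truncated_tree n :: 'x list set))"
    by (intro finite_PiE finite_truncated_tree)
qed

lemma card_Q_pos: "card (Q n) > 0"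
  using finite_Q[of n] G_id by (auto simp: card_gt_0_iff)

lemma finite_fibre: "finite (fibre N n a)"
  using finite_Q[of N] by (simp add: fibre_def)

text \<open>Left multiplication by \<open>s\<close> descends to an injection of \<open>Q N\<close>
  into itself. This supplies the comparisons of fibres that \<open>sum_uniform_fibres\<close> asks
  for.\<close>

lemma card_left_mult_le:
  assumes "s \<in> G" and "\<And>g. g \<in> G \<Longrightarrow> P (tree_proj N g) \<Longrightarrow> P' (tree_proj N (s \<circ> g))"
  shows "card {b \<in> Q N. P b} \<le> card {b \<in> Q N. P' b}"
proof (rule card_inj_on_le)
  have inj: "inj s" using G_auts[OF assms(1)] tree_auts_bij bij_is_inj by blast
  have eq: "tree_proj N (s \<circ> tree_proj N g) = tree_proj N (s \<circ> g)" for g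
    by (simp add: tree_proj_eq_iff tree_proj_apply)
  show "inj_on (\<lambda>b. tree_proj N (s \<circ> b)) {b \<in> Q N. P b}"
    by (rule inj_onI) (auto simp: tree_proj_eq_iff tree_proj_apply inj_eq[OF inj])
  show "(\<lambda>b. tree_proj N (s \<circ> b)) ` {b \<in> Q N. P b} \<subseteq> {b \<in> Q N. P' b}"
    using assms G_comp by (auto simp: eq)
  show "finite {b \<in> Q N. P' b}" using finite_Q[of N] by simp
qed

text \<open>Left multiplication moves any fibre of \<open>Q N\<close> over \<open>Q n\<close> into
  any other, so a uniform element of \<open>Q N\<close> restricts to a uniform element of
  \<open>Q n\<close>.\<close>

lemma mean_tree_proj:
  assumes "n \<le> N"
  shows "mean N (\<lambda>b. f (tree_proj n b)) = mean n f"
proof -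
  have "(\<Sum>b\<in>Q N. f (tree_proj n b)) * real (card (Q n)) = real (card (Q N)) * (\<Sum>a\<in>Q n. f a)"
  proof (rule sum_uniform_fibres[OF finite_Q finite_Q])
    show "tree_proj n ` Q N \<subseteq> Q n" using assms by (auto simp: tree_proj_tree_proj)
    fix a a' assume "a \<in> Q n" "a' \<in> Q n"
    then obtain g g' where g: "g \<in> G" "a = tree_proj n g" "g' \<in> G" "a' = tree_proj n g'" by auto
    obtain s where s: "s \<in> G" "s \<circ> g = g'" using G_div g by blast
    show "card {b \<in> Q N. tree_proj n b = a} \<le> card {b \<in> Q N. tree_proj n b = a'}"
      by (rule card_left_mult_le[OF s(1)])
        (use assms s(2) in \<open>auto simp: g tree_proj_tree_proj tree_proj_eq_iff\<close>)
  qed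
  then show ?thesis using card_Q_pos[of n] card_Q_pos[of N] by (simp add: mean_def field_simps)
qed

lemma mean_mono: "(\<And>b. b \<in> Q n \<Longrightarrow> f b \<le> h b) \<Longrightarrow> mean n f \<le> mean n h"
  by (simp add: mean_def divide_right_mono sum_mono)

text \<open>The tower property of conditional expectation, as an inequality: bounds on all
  conditional means average to a bound on the mean.\<close>

lemma mean_fibrewise_le:
  assumes "n \<le> N"
    and "\<And>a. a \<in> Q n \<Longrightarrow> (\<Sum>b\<in>fibre N n a. f b) \<le> real (card (fibre N n a)) * h a"
  shows "mean N f \<le> mean n h"
proof -
  have sub: "tree_proj n ` Q N \<subseteq> Q n" using assms(1) by (auto simp: tree_proj_tree_proj)
  have "(\<Sum>b\<in>Q N. f b) = (\<Sum>a\<in>Q n. \<Sum>b\<in>fibre N n a. f b)"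
    using sum.group[OF finite_Q finite_Q sub, of f] by (simp add: fibre_def)
  also have "\<dots> \<le> (\<Sum>a\<in>Q n. real (card (fibre N n a)) * h a)"
    by (intro sum_mono assms(2))
  also have "\<dots> = (\<Sum>a\<in>Q n. \<Sum>b\<in>fibre N n a. h (tree_proj n b))"
    by (intro sum.cong) (auto simp: fibre_def)
  also have "\<dots> = (\<Sum>b\<in>Q N. h (tree_proj n b))"
    using sum.group[OF finite_Q finite_Q sub, of "\<lambda>b. h (tree_proj n b)"] by (simp add: fibre_def)
  finally have "mean N f \<le> mean N (\<lambda>b. h (tree_proj n b))"
    by (simp add: mean_def divide_right_mono)
  then show ?thesis using mean_tree_proj[OF assms(1)] by simp
qed

section \<open>Burnside's lemma on a level\<close>

text \<open>By level-transitivity the image of a vertex \<open>v\<close> is uniform on its level, so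
  \<open>v\<close> is fixed with probability one over the size of the level. Summing over all
  \<open>v\<close> gives mean 1.\<close>

lemma sum_fixed_count:
  assumes "n \<ge> 1"
  shows "(\<Sum>b\<in>Q n. real (fixed_count n b)) = real (card (Q n))"
proof -
  let ?L = "level n :: 'x list set"
  have stab: "real (card {b \<in> Q n. b v = v}) * real (card ?L) = real (card (Q n))"
    if v: "v \<in> ?L" for v
  proof -
    have "(\<Sum>b\<in>Q n. of_bool (b v = v)) * real (card ?L) = real (card (Q n)) * (\<Sum>h\<in>?L. of_bool (h = v))"
    proof (rule sum_uniform_fibres[OF finite_Q finite_level, where f = "\<lambda>u. of_bool (u = v)"])
      show "(\<lambda>b. b v) ` Q n \<subseteq> level n"
        using v by (auto simp: level_def tree_proj_apply tree_auts_length[OF G_auts])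
      fix u u' :: "'x list" assume "u \<in> level n" "u' \<in> level n"
      moreover have "level_transitive G" using ssf by (simp add: super_strongly_fractal_def)
      ultimately obtain s where s: "s \<in> G" "s u = u'"
        using assms unfolding level_transitive_def by blast
      show "card {b \<in> Q n. b v = u} \<le> card {b \<in> Q n. b v = u'}"
        by (rule card_left_mult_le[OF s(1)])
          (use s(2) v in \<open>auto simp: tree_proj_apply level_def\<close>)
    qed
    then show ?thesis using v finite_Q[of n]
      by (simp add: of_bool_def sum.If_cases finite_level Int_def conj_commute)
  qed
  have "(\<Sum>b\<in>Q n. real (fixed_count n b)) = (\<Sum>b\<in>Q n. \<Sum>v\<in>?L. of_bool (b v = v))"
    by (simp add: fixed_count_def of_bool_def sum.If_cases finite_level Int_def)
  also have "\<dots> = (\<Sum>v\<in>?L. \<Sum>b\<in>Q n. of_bool (b v = v))"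
    by (rule sum.swap)
  also have "\<dots> = (\<Sum>v\<in>?L. real (card {b \<in> Q n. b v = v}))"
    using finite_Q[of n] by (simp add: of_bool_def sum.If_cases Int_def)
  also have "\<dots> = (\<Sum>v\<in>?L. real (card (Q n)) / real (card ?L))"
    by (intro sum.cong refl) (simp add: card_level flip: stab)
  also have "\<dots> = real (card (Q n))"
    by (simp add: card_level)
  finally show ?thesis .
qed

lemma mean_fixed_count: "n \<ge> 1 \<Longrightarrow> mean n (\<lambda>b. real (fixed_count n b)) = 1"
  using card_Q_pos[of n] by (simp add: mean_def sum_fixed_count)

section \<open>Conditional distribution of sections and the martingale\<close>

text \<open>Let \<open>s\<close> fix level \<open>n\<close> and have section \<open>r\<close> at
  \<open>v\<close>. Left multiplication by \<open>s\<close> keeps the restriction \<open>a\<close>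
  and composes the section at the fixed vertex \<open>v\<close> with \<open>r\<close>. Super strong
  fractality provides such an \<open>s\<close> for every \<open>r\<close> in \<open>G\<close>, so
  any value in \<open>Q m\<close> can be moved to any other.\<close>

lemma section_equidistributed:
  assumes n: "n \<ge> 1" and a: "a \<in> Q n" and v: "v \<in> level n" "a v = v"
  shows "(\<Sum>b\<in>fibre (n + m) n a. f (finite_section m v b)) * real (card (Q m)) =
    real (card (fibre (n + m) n a)) * (\<Sum>h\<in>Q m. f h)"
proof (rule sum_uniform_fibres[OF finite_fibre finite_Q])
  have len: "length v = n" using v by (simp add: level_def)
  show "finite_section m v ` fibre (n + m) n a \<subseteq> Q m"
    using len by (auto simp: fibre_def finite_section_tree_proj G_auts section_in_G)
  fix h h' assume "h \<in> Q m" "h' \<in> Q m"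
  then obtain g g' where g: "g \<in> G" "h = tree_proj m g" "g' \<in> G" "h' = tree_proj m g'" by auto
  obtain r where r: "r \<in> G" "r \<circ> g = g'" using G_div g by blast
  obtain s where s: "s \<in> G" "\<And>u. length u \<le> n \<Longrightarrow> s u = u" "tree_section s v = r"
    using stabilizer_section[OF n v(1) r(1)] by blast
  have "card {b \<in> Q (n + m). tree_proj n b = a \<and> finite_section m v b = h}
      \<le> card {b \<in> Q (n + m). tree_proj n b = a \<and> finite_section m v b = h'}"
  proof (rule card_left_mult_le[OF s(1)])
    fix x assume x: "x \<in> G" and
      *: "tree_proj n (tree_proj (n + m) x) = a \<and> finite_section m v (tree_proj (n + m) x) = h"
    have xs: "s \<circ> x \<in> tree_auts" using G_auts G_comp x s by blast
    have xa: "tree_proj n x = a" using * by (simp add: tree_proj_tree_proj)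
    then have xv: "x v = v" using v len by (metis order_refl tree_proj_apply)
    have "tree_section (s \<circ> x) v = r \<circ> tree_section x v"
      using xv s(2)[of v] len
      by (intro tree_section_eqI[OF xs])
        (simp add: tree_section(2)[OF G_auts[OF x]] tree_section(2)[OF G_auts[OF s(1)]] s(3))
    moreover have "tree_proj m (tree_section x v) = tree_proj m g"
      using * len by (simp add: g finite_section_tree_proj G_auts x)
    then have "tree_proj m (r \<circ> tree_section x v) = tree_proj m g'"
      using r(2) by (auto simp: tree_proj_eq_iff)
    moreover have "tree_proj n (s \<circ> x) = a"
      using s(2) tree_auts_length[OF G_auts[OF x]] by (simp add: tree_proj_eq_iff flip: xa)
    ultimately show "tree_proj n (tree_proj (n + m) (s \<circ> x)) = a \<and>
        finite_section m v (tree_proj (n + m) (s \<circ> x)) = h'"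
      using len by (simp add: tree_proj_tree_proj finite_section_tree_proj xs g)
  qed
  then show "card {b \<in> fibre (n + m) n a. finite_section m v b = h}
      \<le> card {b \<in> fibre (n + m) n a. finite_section m v b = h'}"
    by (simp add: fibre_def conj_assoc)
qed

text \<open>The index set depends only on \<open>a\<close>, not on \<open>b\<close>, so sums over
  the fibre and over the fixed vertices can be interchanged.\<close>

lemma fixed_count_fibre:
  assumes "b \<in> fibre (n + m) n a"
  shows "fixed_count (n + m) b =
    (\<Sum>v\<in>{v \<in> level n. a v = v}. fixed_count m (finite_section m v b))"
proof -
  obtain g where g: "g \<in> G" "b = tree_proj (n + m) g" "tree_proj n g = a"
    using assms by (auto simp: fibre_def tree_proj_tree_proj)
  have ga: "a v = g v" if "v \<in> level n" for v
    using that g(3) by (auto simp: level_def tree_proj_apply)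
  have "fixed_count (n + m) b = (\<Sum>v\<in>{v \<in> level n. g v = v}. fixed_count m (tree_section g v))"
    using fixed_count_add[OF G_auts[OF g(1)]] by (simp add: g(2) fixed_count_tree_proj)
  also have "\<dots> = (\<Sum>v\<in>{v \<in> level n. a v = v}. fixed_count m (finite_section m v b))"
    by (intro sum.cong)
      (auto simp: ga g(2) level_def finite_section_tree_proj G_auts g(1) fixed_count_tree_proj)
  finally show ?thesis .
qed

text \<open>Each vertex fixed by \<open>a\<close> has on average one fixed descendant
  \<open>m\<close> levels below, since its section is uniform in \<open>Q m\<close>. Sections at
  different vertices may be dependent; linearity of the mean is enough.\<close>

lemma fixed_count_martingale:
  assumes n: "n \<ge> 1" and m: "m \<ge> 1" and a: "a \<in> Q n"
  shows "(\<Sum>b\<in>fibre (n + m) n a. real (fixed_count (n + m) b)) =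
    real (card (fibre (n + m) n a)) * real (fixed_count n a)"
proof -
  let ?F = "fibre (n + m) n a" and ?V = "{v \<in> level n. a v = v}"
  have "(\<Sum>b\<in>?F. real (fixed_count (n + m) b)) =
      (\<Sum>b\<in>?F. \<Sum>v\<in>?V. real (fixed_count m (finite_section m v b)))"
    by (intro sum.cong) (simp_all add: fixed_count_fibre)
  also have "\<dots> = (\<Sum>v\<in>?V. \<Sum>b\<in>?F. real (fixed_count m (finite_section m v b)))"
    by (rule sum.swap)
  also have "\<dots> = (\<Sum>v\<in>?V. real (card ?F))"
  proof (intro sum.cong refl)
    fix v assume "v \<in> ?V"
    then have "(\<Sum>b\<in>?F. real (fixed_count m (finite_section m v b))) * real (card (Q m)) =
        real (card ?F) * real (card (Q m))"
      using section_equidistributed[OF n a, of v "\<lambda>h. real (fixed_count m h)" m]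
      by (simp add: sum_fixed_count[OF m])
    then show "(\<Sum>b\<in>?F. real (fixed_count m (finite_section m v b))) = real (card ?F)"
      using card_Q_pos[of m] by simp
  qed
  finally show ?thesis by (simp add: fixed_count_def)
qed

text \<open>The section at one chosen fixed vertex is trivial to depth \<open>m\<close> with
  conditional probability \<open>1 / card (Q m)\<close>, and then all \<open>CARD('x) ^ m\<close>
  descendants of that vertex at this depth are fixed.\<close>

lemma fixed_count_large:
  assumes n: "n \<ge> 1" and a: "a \<in> Q n" and pos: "fixed_count n a \<ge> 1"
  shows "real (card (fibre (n + m) n a)) / real (card (Q m)) \<le>
    real (card {b \<in> fibre (n + m) n a. fixed_count (n + m) b \<ge> CARD('x) ^ m})"
proof -
  let ?F = "fibre (n + m) n a" and ?V = "{v \<in> level n. a v = v}"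
  have "?V \<noteq> {}" using pos unfolding fixed_count_def by (metis card.empty not_one_le_zero)
  then obtain v where v: "v \<in> ?V" by blast
  have id: "tree_proj m id \<in> Q m" using G_id by simp
  have "real (card {b \<in> ?F. finite_section m v b = tree_proj m id}) * real (card (Q m)) = real (card ?F)"
    using section_equidistributed[OF n a, of v "\<lambda>h. of_bool (h = tree_proj m id)" m] v id
    by (simp add: of_bool_def sum.If_cases finite_fibre finite_Q Int_def conj_commute)
  then have "real (card ?F) / real (card (Q m)) = real (card {b \<in> ?F. finite_section m v b = tree_proj m id})"
    using card_Q_pos[of m] by (simp add: field_simps)
  also have "\<dots> \<le> real (card {b \<in> ?F. fixed_count (n + m) b \<ge> CARD('x) ^ m})"
  proof (intro of_nat_mono card_mono)
    show "{b \<in> ?F. finite_section m v b = tree_proj m id} \<subseteq> {b \<in> ?F. fixed_count (n + m) b \<ge> CARD('x) ^ m}"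
    proof (intro subsetI CollectI conjI)
      fix b assume b: "b \<in> {b \<in> ?F. finite_section m v b = tree_proj m id}"
      then show "b \<in> ?F" by simp
      have "CARD('x) ^ m = fixed_count m (finite_section m v b)"
        using b by (simp add: fixed_count_tree_proj) (simp add: fixed_count_def card_level)
      also have "\<dots> \<le> (\<Sum>v\<in>?V. fixed_count m (finite_section m v b))"
        by (rule member_le_sum[OF v]) (simp_all add: finite_level)
      also have "\<dots> = fixed_count (n + m) b"
        using b fixed_count_fibre[of b n m a] by simp
      finally show "CARD('x) ^ m \<le> fixed_count (n + m) b" .
    qed
  qed (simp add: finite_fibre)
  finally show ?thesis .
qed

section \<open>Decrease of the truncated mean\<close>

text \<open>Truncating a martingale at \<open>M\<close> cannot raise its mean. Where the count lies
  strictly between 0 and \<open>M\<close>, it jumps above \<open>M\<close> with conditional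
  probability at least \<open>1 / card (Q m)\<close>, and truncation then costs at least 1.\<close>

lemma mean_min_decrease:
  assumes n: "n \<ge> 1" and m: "m \<ge> 1" and M: "M < CARD('x) ^ m"
  shows "mean (n + m) (\<lambda>b. real (min (fixed_count (n + m) b) M)) \<le>
    mean n (\<lambda>a. real (min (fixed_count n a) M))
      - mean n (\<lambda>a. of_bool (1 \<le> fixed_count n a \<and> fixed_count n a < M)) / real (card (Q m))"
proof -
  let ?c = "real (card (Q m))"
  have "mean (n + m) (\<lambda>b. real (min (fixed_count (n + m) b) M)) \<le>
    mean n (\<lambda>a. real (min (fixed_count n a) M)
      - of_bool (1 \<le> fixed_count n a \<and> fixed_count n a < M) / ?c)"
  proof (rule mean_fibrewise_le)
    fix a assume a: "a \<in> Q n"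
    let ?F = "fibre (n + m) n a"
    have le: "(\<Sum>b\<in>?F. real (min (fixed_count (n + m) b) M)) \<le> real (card ?F) * real (fixed_count n a)"
      unfolding fixed_count_martingale[OF n m a, symmetric] by (intro sum_mono) simp
    consider "M \<le> fixed_count n a" | "fixed_count n a = 0" "0 < M"
      | "1 \<le> fixed_count n a" "fixed_count n a < M" by linarith
    then show "(\<Sum>b\<in>?F. real (min (fixed_count (n + m) b) M)) \<le> real (card ?F) *
        (real (min (fixed_count n a) M) - of_bool (1 \<le> fixed_count n a \<and> fixed_count n a < M) / ?c)"
    proof cases
      case 1
      have "(\<Sum>b\<in>?F. real (min (fixed_count (n + m) b) M)) \<le> (\<Sum>b\<in>?F. real M)"
        by (intro sum_mono) simp
      with 1 show ?thesis by (simp add: min_def split: if_splits)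
    next
      case 2
      with le show ?thesis by simp
    next
      case 3
      \<comment> \<open>A count of at least \<open>CARD('x) ^ m\<close> is an integer greater than
        \<open>M\<close>, so truncation lowers it by at least 1.\<close>
      have "(\<Sum>b\<in>?F. real (min (fixed_count (n + m) b) M)) \<le>
          (\<Sum>b\<in>?F. real (fixed_count (n + m) b) - of_bool (fixed_count (n + m) b \<ge> CARD('x) ^ m))"
        using M by (intro sum_mono) (auto simp: min_def of_bool_def)
      also have "\<dots> = real (card ?F) * real (fixed_count n a)
          - real (card {b \<in> ?F. fixed_count (n + m) b \<ge> CARD('x) ^ m})"
        by (simp add: sum_subtractf fixed_count_martingale[OF n m a])
          (simp add: of_bool_def sum.If_cases finite_fibre Int_def)
      also have "\<dots> \<le> real (card ?F) * real (fixed_count n a) - real (card ?F) / ?c"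
        using fixed_count_large[OF n a 3(1), of m] by simp
      finally show ?thesis using 3 by (simp add: right_diff_distrib)
    qed
  qed simp
  also have "\<dots> = mean n (\<lambda>a. real (min (fixed_count n a) M))
      - mean n (\<lambda>a. of_bool (1 \<le> fixed_count n a \<and> fixed_count n a < M)) / ?c"
    unfolding mean_def sum_subtractf by (simp add: diff_divide_distrib sum_divide_distrib mult.commute)
  finally show ?thesis .
qed

section \<open>Convergence of the fixed-point proportion\<close>

lemma level_FPP_eq_mean: "level_FPP G n = mean n (\<lambda>b. of_bool (1 \<le> fixed_count n b))"
proof -
  have "1 \<le> fixed_count n b \<longleftrightarrow> (\<exists>v\<in>level n. b v = v)" for b :: "'x list \<Rightarrow> 'x list"
    unfolding fixed_count_def Suc_le_eq One_nat_def card_gt_0_iff by (auto simp: finite_level)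
  then show ?thesis
    using finite_Q[of n]
    by (simp add: mean_def level_FPP_def of_bool_def sum.If_cases Int_def)
qed

text \<open>Prefixes of fixed vertices are fixed, so having a fixed vertex on level \<open>N\<close>
  implies having one on level \<open>n\<close>. Both events are compared in
  \<open>Q N\<close>.\<close>

lemma level_FPP_antimono:
  assumes "n \<le> N"
  shows "level_FPP G N \<le> level_FPP G n"
proof -
  have "1 \<le> fixed_count n b" if b: "b \<in> Q N" "1 \<le> fixed_count N b" for b
  proof (rule ccontr)
    assume "\<not> 1 \<le> fixed_count n b"
    moreover obtain g where g: "g \<in> G" "b = tree_proj N g" using b(1) by blast
    ultimately have "fixed_count n g = 0" using assms by (simp add: fixed_count_tree_proj)
    then have "{v \<in> level n. g v = v} = {}" by (simp add: fixed_count_def finite_level)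
    then have "fixed_count N g = 0"
      using fixed_count_add[OF G_auts[OF g(1)], of n "N - n"] assms by (simp del: Collect_empty_eq)
    with b(2) g show False by (simp add: fixed_count_tree_proj)
  qed
  then have "level_FPP G N \<le> mean N (\<lambda>b. of_bool (1 \<le> fixed_count n (tree_proj n b)))"
    unfolding level_FPP_eq_mean by (intro mean_mono) (auto simp: of_bool_def fixed_count_tree_proj)
  then show ?thesis
    using mean_tree_proj[OF assms, of "\<lambda>b. of_bool (1 \<le> fixed_count n b)"]
    by (simp add: level_FPP_eq_mean)
qed

text \<open>Markov's inequality: the count has mean 1, so it reaches \<open>M\<close> with
  probability at most \<open>1 / real M\<close>.\<close>

lemma level_FPP_le_intermediate:
  assumes "n \<ge> 1" "M \<ge> 1"
  shows "level_FPP G n \<le>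
    mean n (\<lambda>a. of_bool (1 \<le> fixed_count n a \<and> fixed_count n a < M)) + 1 / real M"
proof -
  have "level_FPP G n \<le> mean n (\<lambda>a. of_bool (1 \<le> fixed_count n a \<and> fixed_count n a < M)
      + real (fixed_count n a) / real M)"
    unfolding level_FPP_eq_mean using assms(2) by (intro mean_mono) (auto simp: of_bool_def)
  also have "\<dots> = mean n (\<lambda>a. of_bool (1 \<le> fixed_count n a \<and> fixed_count n a < M))
      + mean n (\<lambda>a. real (fixed_count n a)) / real M"
    unfolding mean_def sum.distrib by (simp add: add_divide_distrib sum_divide_distrib mult.commute)
  finally show ?thesis using mean_fixed_count[OF assms(1)] by simp
qed

text \<open>Between levels \<open>m\<close> and \<open>Suc k * m\<close> the truncated mean makes
  \<open>k\<close> drops of at least \<open>?t / ?c\<close>. It starts at most 1 and stays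
  nonnegative, which bounds \<open>?t\<close>.\<close>

lemma level_FPP_bound:
  assumes m: "m \<ge> 1" and M: "M \<ge> 1" "M < CARD('x) ^ m" and k: "k \<ge> 1"
  shows "level_FPP G (k * m) \<le> 1 / real M + real (card (Q m)) / real k"
proof -
  define A where "A n = mean n (\<lambda>a. real (min (fixed_count n a) M))" for n
  define R where "R n = mean n (\<lambda>a. of_bool (1 \<le> fixed_count n a \<and> fixed_count n a < M))" for n
  let ?c = "real (card (Q m))" and ?t = "level_FPP G (k * m) - 1 / real M"
  \<comment> \<open>The steps start at level \<open>m\<close>, not at the root, because the
    estimates require levels of at least 1. For \<open>j < k\<close> the level
    \<open>Suc j * m\<close> is at most \<open>k * m\<close>, so its proportion is at least that of
    level \<open>k * m\<close>.\<close>
  have drop: "A (Suc j * m + m) \<le> A (Suc j * m) - ?t / ?c" if "j < k" for j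
  proof -
    have 1: "Suc j * m \<ge> 1" using m by simp
    have "?t \<le> level_FPP G (Suc j * m) - 1 / real M"
      using that by (intro diff_right_mono level_FPP_antimono mult_le_mono1) simp
    also have "\<dots> \<le> R (Suc j * m)"
      using level_FPP_le_intermediate[OF 1 M(1)] by (simp add: R_def)
    finally have "?t / ?c \<le> R (Suc j * m) / ?c" by (simp add: divide_right_mono)
    then show ?thesis using mean_min_decrease[OF 1 m M(2)] unfolding A_def R_def by linarith
  qed
  have "A (Suc j * m) \<le> 1 - real j * (?t / ?c)" if "j \<le> k" for j
    using that
  proof (induction j)
    case 0
    have "A m \<le> mean m (\<lambda>b. real (fixed_count m b))"
      unfolding A_def by (intro mean_mono) simp
    then show ?case using mean_fixed_count[OF m] by simp
  next
    case (Suc j)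
    then have "A (Suc j * m) \<le> 1 - real j * (?t / ?c)" "A (Suc (Suc j) * m) \<le> A (Suc j * m) - ?t / ?c"
      using drop[of j] by (simp_all add: add.commute add.left_commute)
    then show ?case by (simp add: distrib_right del: times_divide_eq_right mult_Suc)
  qed
  from this[of k] have "A (Suc k * m) \<le> 1 - real k * (?t / ?c)" by simp
  moreover have "0 \<le> A (Suc k * m)" by (simp add: A_def mean_def sum_nonneg)
  ultimately have "real k * (?t / ?c) \<le> 1" by linarith
  then have "?t \<le> ?c / real k"
    using k card_Q_pos[of m] by (simp add: field_simps)
  then show ?thesis by simp
qed

lemma level_FPP_tendsto_0:
  assumes "CARD('x) \<ge> 2"
  shows "level_FPP G \<longlonglongrightarrow> 0"
proof (rule LIMSEQ_I)
  fix r :: real assume r: "r > 0"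
  obtain M where M: "M \<ge> 1" "1 / real M < r / 2"
    using reals_Archimedean[of "r / 2"] r
    by (metis half_gt_zero inverse_eq_divide le_add1 plus_1_eq_Suc)
  \<comment> \<open>One number serves both as truncation bound and as depth, since
    \<open>M < 2 ^ M\<close>.\<close>
  have "M < CARD('x) ^ M"
    using assms less_exp[of M] power_mono[of 2 "CARD('x)" M] by linarith
  note bound = level_FPP_bound[OF M(1) M(1) this]
  let ?c = "real (card (Q M))"
  obtain k where k: "real k > ?c / (r / 2)" using reals_Archimedean2 by blast
  have "k \<ge> 1" using k r by (cases k) (auto simp: field_simps)
  have "?c / real k < r / 2" using k r \<open>k \<ge> 1\<close> by (simp add: field_simps)
  with bound[OF \<open>k \<ge> 1\<close>] M(2) have small: "level_FPP G (k * M) < r" by linarith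
  \<comment> \<open>Monotonicity carries the bound from the single level \<open>k * M\<close> to all
    later ones.\<close>
  have "norm (level_FPP G n - 0) < r" if "n \<ge> k * M" for n
    using level_FPP_antimono[OF that] small by (simp add: level_FPP_def)
  then show "\<exists>no. \<forall>n\<ge>no. norm (level_FPP G n - 0) < r" by blast
qed

end

theorem theorem1:
  fixes G :: "('x::finite list \<Rightarrow> 'x list) set"
  assumes "CARD('x) \<ge> 2"
    and "subgroup G tree_Aut"
    and "super_strongly_fractal G"
  shows "level_FPP G \<longlonglongrightarrow> FPP G \<and> FPP G = 0"
proof -
  interpret ssf_group G by (rule ssf_group.intro) (use assms in auto)
  have "level_FPP G \<longlonglongrightarrow> 0" using assms(1) by (rule level_FPP_tendsto_0)
  then show ?thesis by (simp add: FPP_def limI)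
qed

end
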